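(* Let $p_1<p_2$ be distinct primes. (1) Let $p$ be a prime with $p^d\,\|\,p_1p_2^2+1$ for some positive integer $d$. If $p_1$ is a primitive root modulo $p^d$ and $p_2^2+1\le p$, then a $(p_1p_2^2+1,2,p_1p_2,p_1)$-SEDF does not exist. (2) Let $p$ be a prime with $p^d\,\|\,p_1^2p_2+1$ for some positive integer $d$. If $p_2$ is a primitive root modulo $p^d$ and $p_1^2+1\le p$, then a $(p_1^2p_2+1,2,p_1p_2,p_2)$-SEDF does not exist. (3) Let $p$ be a prime with $p^d\,\|\,p_2^2+1$ for some positive integer $d$. If $p_1$ is a primitive root modulo $p^d$ and $p_2^2+1<p_1p$, or if $p_1$ is a primitive root modulo $p$ and $p_2^2+1=p_1p$, then a $(p_2^2+1,2,p_1p_2,p_1^2)$-SEDF does not exist.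
   Context: Groups are finite abelian, written multiplicatively with identity $1$. For a subset $A\subseteq G$ we also write $A$ for $\sum_{a\in A}a\in\mathbb{Z}[G]$ and $A^{(-1)}=\sum_{a\in A}a^{-1}$. Given integers $m\ge 2$, $k\ge1$, $\lambda\ge 1$ and a group $G$ of order $v$, a collection $\{D_1,\dots,D_m\}$ of mutually disjoint $k$-subsets of $G$ is a $(v,m,k,\lambda)$-strong external difference family (SEDF) in $G$ if $D_j\sum_{i\ne j}D_i^{(-1)}=\lambda(G-1)$ in $\mathbb{Z}[G]$ for each $j$. "Does not exist" means it exists in no abelian group of order $v$. $x^a\,\|\,y$ means $x^a\mid y$ and $x^{a+1}\nmid y$. A prime $q$ is a primitive root modulo $n$ if it generates the multiplicative group of integers modulo $n$. *)

theory Defs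
  imports "HOL-Algebra.Ring" "HOL-Number_Theory.Residue_Primitive_Roots"
begin

text \<open>
  The integral group ring of \<open>G\<close>: integer-valued functions on \<open>carrier G\<close> (extended by
  \<open>0\<close> to the whole type) with pointwise addition and convolution as multiplication.
  All groups considered here are finite, so no finite-support condition is imposed.
\<close>

definition int_group_ring :: "('a, 'b) monoid_scheme \<Rightarrow> ('a \<Rightarrow> int) ring" where
  "int_group_ring G =
     \<lparr> carrier = {f. \<forall>x. x \<notin> carrier G \<longrightarrow> f x = 0},
       monoid.mult = (\<lambda>f g x. if x \<in> carrier G
                 then \<Sum>y\<in>carrier G. f y * g (inv\<^bsub>G\<^esub> y \<otimes>\<^bsub>G\<^esub> x) else 0),
       monoid.one = (\<lambda>x. of_bool (x = \<one>\<^bsub>G\<^esub>)),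
       ring.zero = (\<lambda>x. 0),
       ring.add = (\<lambda>f g x. f x + g x) \<rparr>"

definition gr_elem :: "'a \<Rightarrow> 'a \<Rightarrow> int" where
  "gr_elem a = (\<lambda>x. of_bool (x = a))"

definition gr_set :: "('a, 'b) monoid_scheme \<Rightarrow> 'a set \<Rightarrow> 'a \<Rightarrow> int" where
  "gr_set G A = (\<Oplus>\<^bsub>int_group_ring G\<^esub> a\<in>A. gr_elem a)"

definition gr_set_inv :: "('a, 'b) monoid_scheme \<Rightarrow> 'a set \<Rightarrow> 'a \<Rightarrow> int" where
  "gr_set_inv G A = (\<Oplus>\<^bsub>int_group_ring G\<^esub> a\<in>A. gr_elem (inv\<^bsub>G\<^esub> a))"

text \<open>
  \<open>is_sedf G v m k l D\<close>: the sets \<open>D 1, \<dots>, D m\<close> form a \<open>(v, m, k, l)\<close>-strong external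
  difference family in the abelian group \<open>G\<close>; values of \<open>D\<close> outside \<open>{1..m}\<close> are irrelevant.
\<close>

definition is_sedf ::
  "('a, 'b) monoid_scheme \<Rightarrow> nat \<Rightarrow> nat \<Rightarrow> nat \<Rightarrow> nat \<Rightarrow> (nat \<Rightarrow> 'a set) \<Rightarrow> bool" where
  "is_sedf G v m k l D \<longleftrightarrow>
     comm_group G \<and> finite (carrier G) \<and> order G = v \<and>
     2 \<le> m \<and> 1 \<le> k \<and> 1 \<le> l \<and>
     (\<forall>i\<in>{1..m}. D i \<subseteq> carrier G \<and> card (D i) = k) \<and>
     (\<forall>i\<in>{1..m}. \<forall>j\<in>{1..m}. i \<noteq> j \<longrightarrow> D i \<inter> D j = {}) \<and>
     (\<forall>j\<in>{1..m}.
        gr_set G (D j) \<otimes>\<^bsub>int_group_ring G\<^esub>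
          (\<Oplus>\<^bsub>int_group_ring G\<^esub> i\<in>{1..m} - {j}. gr_set_inv G (D i))
        = [l] \<cdot>\<^bsub>int_group_ring G\<^esub>
            (gr_set G (carrier G) \<ominus>\<^bsub>int_group_ring G\<^esub> \<one>\<^bsub>int_group_ring G\<^esub>))"

definition exactly_divides :: "nat \<Rightarrow> nat \<Rightarrow> nat \<Rightarrow> bool" where
  "exactly_divides x a y \<longleftrightarrow> x ^ a dvd y \<and> \<not> x ^ (a + 1) dvd y"

lemma int_group_ring_simps:
  "f \<in> carrier (int_group_ring G) \<longleftrightarrow> (\<forall>x. x \<notin> carrier G \<longrightarrow> f x = 0)"
  "f \<otimes>\<^bsub>int_group_ring G\<^esub> g = (\<lambda>x. if x \<in> carrier G
     then \<Sum>y\<in>carrier G. f y * g (inv\<^bsub>G\<^esub> y \<otimes>\<^bsub>G\<^esub> x) else 0)"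
  "\<one>\<^bsub>int_group_ring G\<^esub> = (\<lambda>x. of_bool (x = \<one>\<^bsub>G\<^esub>))"
  "\<zero>\<^bsub>int_group_ring G\<^esub> = (\<lambda>x. 0)"
  "f \<oplus>\<^bsub>int_group_ring G\<^esub> g = (\<lambda>x. f x + g x)"
  by (simp_all add: int_group_ring_def)

lemma cring_int_group_ring:
  assumes "comm_group G" and fin: "finite (carrier G)"
  shows "cring (int_group_ring G)"
proof -
  interpret G: comm_group G by fact
  let ?R = "int_group_ring G"
  have comm: "f \<otimes>\<^bsub>?R\<^esub> g = g \<otimes>\<^bsub>?R\<^esub> f" for f g :: "'a \<Rightarrow> int"
  proof
    fix x
    have "(\<Sum>y\<in>carrier G. f y * g (inv\<^bsub>G\<^esub> y \<otimes>\<^bsub>G\<^esub> x))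
        = (\<Sum>y\<in>carrier G. g y * f (inv\<^bsub>G\<^esub> y \<otimes>\<^bsub>G\<^esub> x))" if x: "x \<in> carrier G"
    proof -
      have 1: "inv\<^bsub>G\<^esub> y \<otimes>\<^bsub>G\<^esub> x \<in> carrier G" if "y \<in> carrier G" for y
        using that x by simp
      have 2: "inv\<^bsub>G\<^esub> (inv\<^bsub>G\<^esub> y \<otimes>\<^bsub>G\<^esub> x) \<otimes>\<^bsub>G\<^esub> x = y" if y: "y \<in> carrier G" for y
      proof -
        have "inv\<^bsub>G\<^esub> (inv\<^bsub>G\<^esub> y \<otimes>\<^bsub>G\<^esub> x) \<otimes>\<^bsub>G\<^esub> x = (y \<otimes>\<^bsub>G\<^esub> inv\<^bsub>G\<^esub> x) \<otimes>\<^bsub>G\<^esub> x"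
          using x y by (simp add: G.inv_mult)
        also have "\<dots> = y" using x y by (simp add: G.m_assoc)
        finally show ?thesis .
      qed
      show ?thesis
        by (rule sum.reindex_bij_witness[of _ "\<lambda>y. inv\<^bsub>G\<^esub> y \<otimes>\<^bsub>G\<^esub> x" "\<lambda>y. inv\<^bsub>G\<^esub> y \<otimes>\<^bsub>G\<^esub> x"])
          (simp_all add: 1 2 mult.commute)
    qed
    then show "(f \<otimes>\<^bsub>?R\<^esub> g) x = (g \<otimes>\<^bsub>?R\<^esub> f) x" by (simp add: int_group_ring_simps)
  qed
  have assoc: "(f \<otimes>\<^bsub>?R\<^esub> g) \<otimes>\<^bsub>?R\<^esub> h = f \<otimes>\<^bsub>?R\<^esub> (g \<otimes>\<^bsub>?R\<^esub> h)" for f g h :: "'a \<Rightarrow> int"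
  proof
    fix x
    have "(\<Sum>y\<in>carrier G. (\<Sum>z\<in>carrier G. f z * g (inv\<^bsub>G\<^esub> z \<otimes>\<^bsub>G\<^esub> y)) * h (inv\<^bsub>G\<^esub> y \<otimes>\<^bsub>G\<^esub> x))
        = (\<Sum>z\<in>carrier G. f z * (\<Sum>y\<in>carrier G. g y * h (inv\<^bsub>G\<^esub> y \<otimes>\<^bsub>G\<^esub> (inv\<^bsub>G\<^esub> z \<otimes>\<^bsub>G\<^esub> x))))"
      (is "?L = ?M") if x: "x \<in> carrier G"
    proof -
      have "?L = (\<Sum>z\<in>carrier G. \<Sum>y\<in>carrier G. f z * (g (inv\<^bsub>G\<^esub> z \<otimes>\<^bsub>G\<^esub> y) * h (inv\<^bsub>G\<^esub> y \<otimes>\<^bsub>G\<^esub> x)))"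
        unfolding sum_distrib_right by (subst sum.swap) (simp add: mult.assoc)
      also have "\<dots> = (\<Sum>z\<in>carrier G. \<Sum>y\<in>carrier G. f z * (g y * h (inv\<^bsub>G\<^esub> y \<otimes>\<^bsub>G\<^esub> (inv\<^bsub>G\<^esub> z \<otimes>\<^bsub>G\<^esub> x))))"
      proof (rule sum.cong[OF refl])
        fix z assume z: "z \<in> carrier G"
        show "(\<Sum>y\<in>carrier G. f z * (g (inv\<^bsub>G\<^esub> z \<otimes>\<^bsub>G\<^esub> y) * h (inv\<^bsub>G\<^esub> y \<otimes>\<^bsub>G\<^esub> x)))
            = (\<Sum>y\<in>carrier G. f z * (g y * h (inv\<^bsub>G\<^esub> y \<otimes>\<^bsub>G\<^esub> (inv\<^bsub>G\<^esub> z \<otimes>\<^bsub>G\<^esub> x))))"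
        proof -
          have 1: "z \<otimes>\<^bsub>G\<^esub> (inv\<^bsub>G\<^esub> z \<otimes>\<^bsub>G\<^esub> y) = y" "inv\<^bsub>G\<^esub> z \<otimes>\<^bsub>G\<^esub> (z \<otimes>\<^bsub>G\<^esub> y) = y"
            if "y \<in> carrier G" for y
            using that z by (simp_all add: G.m_assoc[symmetric])
          have 2: "inv\<^bsub>G\<^esub> (inv\<^bsub>G\<^esub> z \<otimes>\<^bsub>G\<^esub> y) \<otimes>\<^bsub>G\<^esub> (inv\<^bsub>G\<^esub> z \<otimes>\<^bsub>G\<^esub> x) = inv\<^bsub>G\<^esub> y \<otimes>\<^bsub>G\<^esub> x"
            if y: "y \<in> carrier G" for y
          proof -
            have "inv\<^bsub>G\<^esub> (inv\<^bsub>G\<^esub> z \<otimes>\<^bsub>G\<^esub> y) = inv\<^bsub>G\<^esub> y \<otimes>\<^bsub>G\<^esub> z"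
              using y z by (simp add: G.inv_mult_group)
            then show ?thesis using x y z 1(1)[of x] by (simp add: G.m_assoc)
          qed
          show ?thesis
            by (rule sum.reindex_bij_witness[of _ "\<lambda>y. z \<otimes>\<^bsub>G\<^esub> y" "\<lambda>y. inv\<^bsub>G\<^esub> z \<otimes>\<^bsub>G\<^esub> y"])
              (use z in \<open>simp_all add: 1 2\<close>)
        qed
      qed
      also have "\<dots> = ?M" by (simp add: sum_distrib_left)
      finally show ?thesis .
    qed
    then show "((f \<otimes>\<^bsub>?R\<^esub> g) \<otimes>\<^bsub>?R\<^esub> h) x = (f \<otimes>\<^bsub>?R\<^esub> (g \<otimes>\<^bsub>?R\<^esub> h)) x"
      by (simp add: int_group_ring_simps cong: sum.cong)
  qed
  have one: "\<one>\<^bsub>?R\<^esub> \<otimes>\<^bsub>?R\<^esub> f = f" if f: "f \<in> carrier ?R" for f :: "'a \<Rightarrow> int"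
  proof
    fix x
    have "(\<Sum>y\<in>carrier G. of_bool (y = \<one>\<^bsub>G\<^esub>) * f (inv\<^bsub>G\<^esub> y \<otimes>\<^bsub>G\<^esub> x))
        = (\<Sum>y\<in>carrier G. if y = \<one>\<^bsub>G\<^esub> then f (inv\<^bsub>G\<^esub> y \<otimes>\<^bsub>G\<^esub> x) else 0)"
      by (rule sum.cong) auto
    also have "\<dots> = f x" if "x \<in> carrier G"
      using that fin by simp
    finally show "(\<one>\<^bsub>?R\<^esub> \<otimes>\<^bsub>?R\<^esub> f) x = f x"
      using f by (auto simp: int_group_ring_simps)
  qed
  have "abelian_group ?R"
  proof (rule abelian_groupI)
    fix f assume "f \<in> carrier ?R"
    then show "\<exists>g\<in>carrier ?R. g \<oplus>\<^bsub>?R\<^esub> f = \<zero>\<^bsub>?R\<^esub>"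
      by (intro bexI[of _ "\<lambda>x. - f x"]) (auto simp: int_group_ring_simps)
  qed (auto simp: int_group_ring_simps)
  moreover have "comm_monoid ?R"
    by (rule comm_monoidI; (rule assoc | rule comm | erule one)?)
      (auto simp: int_group_ring_simps)
  ultimately show ?thesis
    by (rule cringI) (auto simp: int_group_ring_simps fun_eq_iff sum.distrib distrib_right)
qed

lemma finsum_int_group_ring:
  assumes "comm_group G" "finite (carrier G)" "finite A" "F \<in> A \<rightarrow> carrier (int_group_ring G)"
  shows "(\<Oplus>\<^bsub>int_group_ring G\<^esub> a\<in>A. F a) = (\<lambda>x. \<Sum>a\<in>A. F a x)"
proof -
  interpret R: cring "int_group_ring G" using assms(1,2) by (rule cring_int_group_ring)
  show ?thesis using assms(3,4)
  proof (induction A rule: finite_induct)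
    case empty
    then show ?case by (simp add: int_group_ring_simps)
  next
    case (insert a A)
    then show ?case by (simp add: R.finsum_insert int_group_ring_simps(5))
  qed
qed

lemma gr_set_eq:
  assumes "comm_group G" "finite (carrier G)" "A \<subseteq> carrier G"
  shows "gr_set G A = (\<lambda>x. of_bool (x \<in> A))"
proof -
  have fin: "finite A" using assms(2,3) by (rule rev_finite_subset)
  have "gr_set G A = (\<lambda>x. \<Sum>a\<in>A. gr_elem a x)"
    unfolding gr_set_def using assms fin
    by (intro finsum_int_group_ring) (auto simp: int_group_ring_simps gr_elem_def)
  then show ?thesis using fin by (simp add: gr_elem_def of_bool_def fun_eq_iff)
qed

end

theory Submission
  imports Defs "HOL-Algebra.Sylow" "HOL-Computational_Algebra.Polynomial"
begin

text \<open>
  Let \<open>q\<close> be the prime dividing \<open>\<lambda>\<close> that is a primitive root modulo \<open>p\<close>; in all cases \<open>v \<le> p q\<close>.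
  Push the two sets \<open>A\<close>, \<open>B\<close> forward along an epimorphism from \<open>G\<close> to the cyclic group of order \<open>p\<close>.
  The product of the image of \<open>A\<close> with the inverted image of \<open>B\<close> vanishes modulo \<open>q\<close>, and \<open>q\<close> is inert in \<open>\<int>[\<zeta>\<^sub>p]\<close>,
  so one of the two images has all its coefficients congruent modulo \<open>q\<close>. These coefficients are at
  most \<open>v / p \<le> q\<close>, hence they are all equal or all in \<open>{0, v / p}\<close> with \<open>v / p = q\<close>; both
  contradict the difference property.
\<close>

subsection \<open>Cyclic coefficients of integer polynomials\<close>

text \<open>
  \<open>cyc p f i\<close> is the coefficient of \<open>X ^ i\<close> in the image of \<open>f\<close> in \<open>\<int>[X]/(X ^ p - 1)\<close>, the group
  ring of the cyclic group of order \<open>p\<close>. In that ring modulo \<open>q\<close>, \<open>null_mod\<close> means zero and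
  \<open>flat_mod\<close> means a scalar multiple of \<open>1 + X + \<dots> + X ^ (p - 1)\<close>, that is, zero in \<open>\<int>[\<zeta>\<^sub>p]/(q)\<close>.
\<close>

definition cyc :: "nat \<Rightarrow> int poly \<Rightarrow> nat \<Rightarrow> int" where
  "cyc p f i = (\<Sum>j | j \<le> degree f \<and> [j = i] (mod p). Polynomial.coeff f j)"

definition null_mod :: "nat \<Rightarrow> nat \<Rightarrow> int poly \<Rightarrow> bool" where
  "null_mod p q f \<longleftrightarrow> (\<forall>i. int q dvd cyc p f i)"

definition flat_mod :: "nat \<Rightarrow> nat \<Rightarrow> int poly \<Rightarrow> bool" where
  "flat_mod p q f \<longleftrightarrow> (\<forall>i j. int q dvd cyc p f i - cyc p f j)"

text \<open>Coefficients beyond the degree vanish, so any larger bound \<open>N\<close> serves; a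
  common bound lets polynomials of different degrees be added termwise.\<close>

lemma cyc_eq:
  assumes "degree f \<le> N"
  shows "cyc p f i = (\<Sum>j\<le>N. if [j = i] (mod p) then Polynomial.coeff f j else 0)"
proof -
  have "(\<Sum>j\<le>N. if [j = i] (mod p) then Polynomial.coeff f j else 0)
      = (\<Sum>j | j \<in> {..N} \<and> [j = i] (mod p). Polynomial.coeff f j)"
    by (rule sum.inter_filter[symmetric]) simp
  also have "\<dots> = cyc p f i"
    unfolding cyc_def using assms by (intro sum.mono_neutral_right) (auto intro: coeff_eq_0)
  finally show ?thesis ..
qed

lemma cyc_add: "cyc p (f + g) i = cyc p f i + cyc p g i"
proof -
  let ?N = "max (degree f) (degree g)"
  have "degree (f + g) \<le> ?N" by (rule degree_add_le_max)
  then show ?thesis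
    by (subst (1 2 3) cyc_eq[where N = ?N]) (auto simp: sum.distrib[symmetric] intro!: sum.cong)
qed

lemma cyc_0 [simp]: "cyc p 0 i = 0"
  by (simp add: cyc_def)

lemma cyc_diff: "cyc p (f - g) i = cyc p f i - cyc p g i"
  using cyc_add[of p "f - g" g i] by simp

lemma cyc_sum: "cyc p (\<Sum>x\<in>S. F x) i = (\<Sum>x\<in>S. cyc p (F x) i)"
  by (induction S rule: infinite_finite_induct) (simp_all add: cyc_add)

lemma cyc_smult: "cyc p (smult c f) i = c * cyc p f i"
  by (subst (1 2) cyc_eq[where N = "degree f"])
    (auto simp: sum_distrib_left intro!: sum.cong)

lemma cyc_monom: "cyc p (Polynomial.monom c n) i = (if [n = i] (mod p) then c else 0)"
proof -
  have "cyc p (Polynomial.monom c n) i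
      = (\<Sum>j\<le>n. if j = n then if [n = i] (mod p) then c else 0 else 0)"
    by (subst cyc_eq[where N = n, OF degree_monom_le]) (rule sum.cong, auto)
  also have "\<dots> = (if [n = i] (mod p) then c else 0)"
    by (simp only: sum.delta finite_atMost) simp
  finally show ?thesis .
qed

lemma cyc_const: "cyc p [:c:] i = (if [0 = i] (mod p) then c else 0)"
  using cyc_monom[of p c 0 i] by (simp add: monom_0)

lemma cyc_mod: "cyc p f (i mod p) = cyc p f i"
  by (simp add: cyc_def cong_def)

lemma cyc_mult_monom: "cyc p (f * Polynomial.monom c n) (i + n) = c * cyc p f i"
proof -
  have "f * Polynomial.monom c n
      = (\<Sum>j\<le>degree f. Polynomial.monom (Polynomial.coeff f j) j) * Polynomial.monom c n"
    by (simp add: poly_as_sum_of_monoms)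
  also have "\<dots> = (\<Sum>j\<le>degree f. Polynomial.monom (c * Polynomial.coeff f j) (j + n))"
    by (simp add: sum_distrib_right mult_monom) (simp add: mult.commute)
  finally show ?thesis
    by (auto simp: cyc_sum cyc_monom cyc_eq[of f "degree f"] sum_distrib_left
        cong_add_rcancel_nat intro!: sum.cong)
qed

text \<open>The index \<open>i + n * (p - 1)\<close> stands for \<open>i - n\<close> modulo
  \<open>p\<close>, which avoids truncated subtraction.\<close>

lemma cyc_mult_monom':
  assumes "0 < p"
  shows "cyc p (f * Polynomial.monom c n) i = c * cyc p f (i + n * (p - 1))"
proof -
  have "i + n * (p - 1) + n = i + n * p"
    using assms by (cases p) auto
  then have "(i + n * (p - 1) + n) mod p = i mod p" by (metis mod_mult_self1)
  then show ?thesis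
    using cyc_mult_monom[of p f c n "i + n * (p - 1)"] by (metis cyc_mod)
qed

section \<open>Substituting a power of the variable\<close>

lemma pcompose_monom:
  "pcompose f (Polynomial.monom 1 n)
    = (\<Sum>j\<le>degree f. Polynomial.monom (Polynomial.coeff f j) (n * j))" for f :: "int poly"
proof -
  have *: "pcompose (Polynomial.monom c j) (Polynomial.monom 1 n) = Polynomial.monom c (n * j)"
    for c :: int and j
  proof (induction j)
    case (Suc j)
    then show ?case by (simp add: monom_Suc pcompose_pCons mult_monom)
  qed (simp add: monom_0)
  have "pcompose (\<Sum>j\<le>degree f. Polynomial.monom (Polynomial.coeff f j) j) (Polynomial.monom 1 n)
      = (\<Sum>j\<le>degree f. Polynomial.monom (Polynomial.coeff f j) (n * j))"
    by (simp add: pcompose_sum *)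
  then show ?thesis by (simp add: poly_as_sum_of_monoms)
qed

lemma cyc_pcompose_monom:
  "cyc p (pcompose f (Polynomial.monom 1 n)) i
    = (\<Sum>j\<le>degree f. if [n * j = i] (mod p) then Polynomial.coeff f j else 0)"
  by (simp add: pcompose_monom cyc_sum cyc_monom)

lemma cyc_pcompose_cong_1:
  assumes "[n = 1] (mod p)"
  shows "cyc p (pcompose f (Polynomial.monom 1 n)) i = cyc p f i"
proof -
  have "[n * j = i] (mod p) \<longleftrightarrow> [j = i] (mod p)" for j
    using cong_mult[OF assms cong_refl[of j]] by (auto simp: cong_def)
  then show ?thesis by (simp add: cyc_pcompose_monom cyc_eq[of f "degree f"])
qed

text \<open>Multiplication by a unit \<open>n\<close> permutes the residues modulo \<open>p\<close>,
  so the substitution permutes the cyclic coefficients.\<close>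

lemma cyc_pcompose_coprime:
  assumes "coprime n p"
  shows "cyc p (pcompose f (Polynomial.monom 1 n)) (n * i) = cyc p f i"
  using assms by (simp add: cyc_pcompose_monom cyc_eq[of f "degree f"] cong_mult_lcancel_nat)

section \<open>Null and flat elements as ideals\<close>

lemma null_mod_0 [simp]: "null_mod p q 0"
  by (simp add: null_mod_def)

lemma null_mod_add: "null_mod p q f \<Longrightarrow> null_mod p q g \<Longrightarrow> null_mod p q (f + g)"
  by (simp add: null_mod_def cyc_add)

lemma null_mod_diff: "null_mod p q f \<Longrightarrow> null_mod p q g \<Longrightarrow> null_mod p q (f - g)"
  by (simp add: null_mod_def cyc_diff)

lemma null_mod_smult: "int q dvd c \<Longrightarrow> null_mod p q (smult c f)"
  by (simp add: null_mod_def cyc_smult)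

lemma flat_mod_add: "flat_mod p q f \<Longrightarrow> flat_mod p q g \<Longrightarrow> flat_mod p q (f + g)"
  unfolding flat_mod_def cyc_add by (metis add_diff_add dvd_add)

lemma flat_mod_diff: "flat_mod p q f \<Longrightarrow> flat_mod p q g \<Longrightarrow> flat_mod p q (f - g)"
  unfolding flat_mod_def cyc_diff by (metis diff_diff_eq2 diff_add_eq add_diff_eq dvd_diff diff_diff_add add.commute)

lemma null_imp_flat_mod: "null_mod p q f \<Longrightarrow> flat_mod p q f"
  by (simp add: null_mod_def flat_mod_def)

text \<open>A monomial factor only shifts and scales the cyclic coefficients; linearity does the
  rest. The same reason serves \<open>flat_mod_mult\<close>.\<close>

lemma null_mod_mult:
  assumes "0 < p" "null_mod p q f"
  shows "null_mod p q (f * g)"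
proof -
  have "null_mod p q (f * (\<Sum>j\<le>degree g. Polynomial.monom (Polynomial.coeff g j) j))"
    using assms unfolding null_mod_def
    by (auto simp: sum_distrib_left cyc_sum cyc_mult_monom' intro!: dvd_sum)
  then show ?thesis by (simp add: poly_as_sum_of_monoms)
qed

lemma flat_mod_mult:
  assumes "0 < p" "flat_mod p q f"
  shows "flat_mod p q (f * g)"
proof -
  have "flat_mod p q (f * (\<Sum>j\<le>degree g. Polynomial.monom (Polynomial.coeff g j) j))"
    using assms unfolding flat_mod_def
    by (auto simp: sum_distrib_left cyc_sum cyc_mult_monom' sum_subtractf[symmetric]
        right_diff_distrib[symmetric] intro!: dvd_sum)
  then show ?thesis by (simp add: poly_as_sum_of_monoms)
qed

lemma null_mod_power_diff:
  assumes "0 < p" "null_mod p q (f - g)"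
  shows "null_mod p q (f ^ n - g ^ n)"
  using null_mod_mult[OF assms] by (simp add: power_diff_sumr2)

section \<open>The Frobenius congruence modulo \<open>q\<close>\<close>

lemma freshmans_dream_poly:
  fixes f g :: "int poly"
  assumes q: "prime q"
  shows "\<exists>h. (f + g) ^ q = f ^ q + g ^ q + smult (int q) h"
proof -
  have dvd: "[:int q:] dvd of_nat (q choose k) * f ^ k * g ^ (q - k)" if "k \<in> {0<..<q}" for k
  proof -
    have "q dvd (q choose k)" using that q by (intro dvd_choose_prime) auto
    then obtain m where "q choose k = q * m" ..
    then have "of_nat (q choose k) = [:int q:] * (of_nat m :: int poly)"
      by (simp add: of_nat_poly)
    then show ?thesis by (metis dvd_triv_left dvd_mult2)
  qed
  have q0: "q > 0" using q by (simp add: prime_gt_0_nat)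
  have "(f + g) ^ q = (\<Sum>k\<le>q. of_nat (q choose k) * f ^ k * g ^ (q - k))"
    by (rule binomial_ring)
  also have "{..q} = insert 0 (insert q {0<..<q})" using q0 by auto
  also have "(\<Sum>k\<in>\<dots>. of_nat (q choose k) * f ^ k * g ^ (q - k))
      = f ^ q + g ^ q + (\<Sum>k\<in>{0<..<q}. of_nat (q choose k) * f ^ k * g ^ (q - k))"
    using q0 by simp
  finally have "(f + g) ^ q = \<dots>" .
  moreover have "[:int q:] dvd (\<Sum>k\<in>{0<..<q}. of_nat (q choose k) * f ^ k * g ^ (q - k))"
    using dvd by (rule dvd_sum)
  then obtain h where "(\<Sum>k\<in>{0<..<q}. of_nat (q choose k) * f ^ k * g ^ (q - k)) = [:int q:] * h" ..
  ultimately show ?thesis by auto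
qed

lemma int_power_prime_cong:
  fixes a :: int
  assumes "prime q"
  shows "[a ^ q = a] (mod int q)"
proof -
  have nat: "[n ^ q = n] (mod q)" for n
  proof (cases "q dvd n")
    case True
    then show ?thesis using assms prime_gt_0_nat[OF assms]
      by (metis cong_0_iff cong_sym cong_trans dvd_power dvd_trans)
  next
    case False
    from fermat_theorem[OF assms False] have "[n * n ^ (q - 1) = n * 1] (mod q)"
      by (rule cong_scalar_left)
    then show ?thesis using prime_gt_0_nat[OF assms] by (simp add: power_eq_if)
  qed
  have q0: "int q > 0" using prime_gt_0_nat[OF assms] by simp
  define n where "n = nat (a mod int q)"
  have n: "[a = int n] (mod int q)" using q0 by (simp add: n_def cong_def)
  have "[a ^ q = int n ^ q] (mod int q)" using n by (rule cong_pow)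
  also have "[int n ^ q = int n] (mod int q)" using nat[of n] by (metis cong_int_iff of_nat_power)
  also have "[int n = a] (mod int q)" using n by (rule cong_sym)
  finally show ?thesis .
qed

text \<open>Induction on the coefficients, writing \<open>pCons a f\<close> as a constant plus
  \<open>X * f\<close>: the binomial expansion splits the power, and Fermat's little theorem fixes
  the constant.\<close>

lemma frobenius_poly:
  fixes f :: "int poly"
  assumes q: "prime q"
  shows "\<exists>h. f ^ q = pcompose f (Polynomial.monom 1 q) + smult (int q) h"
proof (induction f)
  case 0
  then show ?case using prime_gt_0_nat[OF q] by (intro exI[of _ 0]) simp
next
  case (pCons a f)
  from pCons.IH obtain h1 where h1: "f ^ q = pcompose f (Polynomial.monom 1 q) + smult (int q) h1" ..
  obtain h2 where h2: "([:a:] + Polynomial.monom 1 1 * f) ^ q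
      = [:a:] ^ q + (Polynomial.monom 1 1 * f) ^ q + smult (int q) h2"
    using freshmans_dream_poly[OF q] by blast
  from int_power_prime_cong[OF q, of a] obtain c where c: "a ^ q = a + int q * c"
    by (metis cong_iff_lin cong_sym)
  have "pCons a f = [:a:] + Polynomial.monom 1 1 * f"
    by (simp add: monom_altdef)
  then have "pCons a f ^ q = [:a ^ q:] + Polynomial.monom 1 q * f ^ q + smult (int q) h2"
    using h2 by (simp add: poly_const_pow power_mult_distrib monom_power)
  also have "\<dots> = pcompose (pCons a f) (Polynomial.monom 1 q)
      + smult (int q) ([:c:] + Polynomial.monom 1 q * h1 + h2)"
    by (simp add: h1 c pcompose_pCons algebra_simps smult_add_right)
  finally show ?case ..
qed

text \<open>Frobenius iterated \<open>m\<close> times: \<open>null_mod_power_diff\<close> raises the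
  previous congruence to the power \<open>q\<close>, and multiples of \<open>q\<close> are
  null.\<close>

lemma null_mod_frobenius:
  assumes "prime q" "0 < p"
  shows "null_mod p q (f ^ (q ^ m) - pcompose f (Polynomial.monom 1 (q ^ m)))"
proof (induction m)
  case 0
  have "pcompose f (Polynomial.monom 1 1) = f"
    by (simp add: pcompose_monom poly_as_sum_of_monoms)
  then show ?case by simp
next
  case (Suc m)
  let ?g = "pcompose f (Polynomial.monom 1 (q ^ m))"
  obtain h where h: "?g ^ q = pcompose ?g (Polynomial.monom 1 q) + smult (int q) h"
    using frobenius_poly[OF assms(1)] by blast
  have "pcompose (Polynomial.monom 1 n) (Polynomial.monom 1 q) = Polynomial.monom (1::int) (q * n)" for n
    by (subst pcompose_monom) (simp add: degree_monom_eq if_distrib[of "\<lambda>c. Polynomial.monom c _"] cong: if_cong)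
  then have "pcompose ?g (Polynomial.monom 1 q) = pcompose f (Polynomial.monom 1 (q ^ Suc m))"
    by (simp flip: pcompose_assoc)
  then have "f ^ q ^ Suc m - pcompose f (Polynomial.monom 1 (q ^ Suc m))
      = ((f ^ q ^ m) ^ q - ?g ^ q) + smult (int q) h"
    using h by (simp add: power_mult[symmetric] mult.commute)
  moreover have "null_mod p q ((f ^ q ^ m) ^ q - ?g ^ q)"
    using assms(2) Suc.IH by (rule null_mod_power_diff)
  ultimately show ?case by (simp add: null_mod_add null_mod_smult)
qed


text \<open>
  Primality of \<open>q\<close> in \<open>\<int>[\<zeta>\<^sub>p]\<close>, without fields: by Frobenius \<open>e = f ^ (q ^ (p - 1) - 1)\<close> is idempotent
  modulo \<open>q\<close> and \<open>X ^ p - 1\<close> and invariant under \<open>X \<mapsto> X ^ q\<close>. As \<open>q\<close> generates the units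
  modulo \<open>p\<close>, \<open>e\<close> is a constant \<open>\<alpha>\<close> plus a flat element, and \<open>\<alpha>\<close> is \<open>0\<close> or \<open>1\<close> modulo \<open>q\<close>.
\<close>

lemma flat_mod_or_flat_mod:
  assumes p: "prime p" and q: "prime q" and cop: "coprime q p"
    and gen: "\<And>i. \<not> p dvd i \<Longrightarrow> \<exists>j. [q ^ j = i] (mod p)"
    and fg: "null_mod p q (f * g)"
  shows "flat_mod p q f \<or> flat_mod p q g"
proof -
  have p0: "0 < p" using p by (rule prime_gt_0_nat)
  have p1: "1 < p" using p by (rule prime_gt_1_nat)
  define M where "M = q ^ (p - 1)"
  have "q ^ 1 \<le> M"
    unfolding M_def using p1 q by (intro power_increasing) (auto simp: prime_gt_0_nat Suc_leI)
  then have M2: "2 \<le> M" using prime_ge_2_nat[OF q] by simp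
  then obtain N where N: "M = Suc (Suc N)" by (metis add_2_eq_Suc le_Suc_ex)
  have "\<not> p dvd q" using cop p1 by (metis coprime_absorb_right not_prime_unit p)
  \<comment> \<open>Since \<open>M\<close> is 1 modulo \<open>p\<close>, substituting
    \<open>X ^ M\<close> for \<open>X\<close> leaves all cyclic coefficients unchanged, and
    Frobenius becomes \<open>f ^ M = f\<close> modulo \<open>q\<close>.\<close>
  then have M1: "[M = 1] (mod p)" unfolding M_def by (rule fermat_theorem[OF p])
  have "null_mod p q (f ^ M - pcompose f (Polynomial.monom 1 M))"
    unfolding M_def by (rule null_mod_frobenius[OF q p0])
  then have fM: "null_mod p q (f ^ M - f)"
    by (simp add: null_mod_def cyc_diff cyc_pcompose_cong_1[OF M1])
  define e where "e = f ^ (M - 1)"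
  \<comment> \<open>Here \<open>N\<close> is \<open>M - 2\<close>, so \<open>e\<close> is
    \<open>f ^ (N + 1)\<close> and \<open>e * e\<close> is \<open>f ^ M * f ^ N\<close>.\<close>
  have "e * e - e = (f ^ M - f) * f ^ N"
    by (simp add: e_def N algebra_simps)
  then have ee: "null_mod p q (e * e - e)"
    using null_mod_mult[OF p0 fM] by simp
  have "null_mod p q (e ^ Suc n - e)" for n
  proof (induction n)
    case (Suc n)
    have "e ^ Suc (Suc n) - e = (e ^ Suc n - e) * e + (e * e - e)"
      by (simp add: algebra_simps)
    then show ?case
      using null_mod_add[OF null_mod_mult[OF p0 Suc] ee] by metis
  qed simp
  from this[of "q - 1"] have "null_mod p q (e ^ q - e)" using prime_gt_0_nat[OF q] by simp
  moreover have "null_mod p q (e ^ (q ^ 1) - pcompose e (Polynomial.monom 1 (q ^ 1)))"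
    by (rule null_mod_frobenius[OF q p0])
  ultimately have "null_mod p q ((e ^ q - e) - (e ^ q - pcompose e (Polynomial.monom 1 q)))"
    by (metis null_mod_diff power_one_right)
  then have "null_mod p q (pcompose e (Polynomial.monom 1 q) - e)" by simp
  then have "int q dvd cyc p (pcompose e (Polynomial.monom 1 q) - e) (q * i)" for i
    by (simp add: null_mod_def)
  then have step: "int q dvd cyc p e i - cyc p e (q * i)" for i
    by (simp add: cyc_diff cyc_pcompose_coprime[OF cop])
  have pow: "int q dvd cyc p e 1 - cyc p e (q ^ j)" for j
  proof (induction j)
    case (Suc j)
    then show ?case using dvd_add[OF Suc step[of "q ^ j"]] by simp
  qed simp
  have off0: "int q dvd cyc p e i - cyc p e 1" if "\<not> p dvd i" for i
  proof -
    from gen[OF that] obtain j where "[q ^ j = i] (mod p)" ..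
    then have "cyc p e (q ^ j) = cyc p e i" by (metis cyc_mod cong_def)
    then show ?thesis using pow[of j] by (simp add: dvd_diff_commute)
  qed
  \<comment> \<open>Subtracting the constant \<alpha> alters only the coefficient at residue 0,
    which then equals the one at 1; so the remainder \<open>h\<close> is flat.\<close>
  define \<alpha> where "\<alpha> = cyc p e 0 - cyc p e 1"
  define h where "h = e - [:\<alpha>:]"
  have h1: "int q dvd cyc p h i - cyc p e 1" for i
  proof (cases "p dvd i")
    case True
    then have "cyc p e i = cyc p e 0" by (metis cyc_mod mod_0 mod_eq_0_iff_dvd)
    moreover have "[0 = i] (mod p)" using True by (simp add: cong_def mod_eq_0_iff_dvd)
    ultimately show ?thesis by (simp add: h_def cyc_diff cyc_const \<alpha>_def)
  next
    case False
    then have "\<not> [0 = i] (mod p)" by (metis cong_0_iff cong_sym)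
    then show ?thesis using off0[OF False] by (simp add: h_def cyc_diff cyc_const)
  qed
  have h: "flat_mod p q h"
    unfolding flat_mod_def
  proof (intro allI)
    fix i j
    show "int q dvd cyc p h i - cyc p h j" using dvd_diff[OF h1[of i] h1[of j]] by simp
  qed
  \<comment> \<open>Expanding \<open>e * e - e\<close> with \<open>e = h + \<alpha>\<close> shows
    that this constant is flat. Its coefficients at 1 and 0 are 0 and the constant itself, so
    \<open>q\<close> divides it.\<close>
  have "[:\<alpha> * \<alpha> - \<alpha>:] = (e * e - e) - h * (e + [:\<alpha>:] - 1)"
    by (simp add: h_def algebra_simps)
  then have "flat_mod p q [:\<alpha> * \<alpha> - \<alpha>:]"
    using flat_mod_diff[OF null_imp_flat_mod[OF ee] flat_mod_mult[OF p0 h]] by simp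
  then have "int q dvd cyc p [:\<alpha> * \<alpha> - \<alpha>:] 0 - cyc p [:\<alpha> * \<alpha> - \<alpha>:] 1"
    by (simp add: flat_mod_def)
  then have "int q dvd \<alpha> * (\<alpha> - 1)"
    using p1 by (simp add: cyc_const cong_def algebra_simps)
  then consider "int q dvd \<alpha>" | "int q dvd \<alpha> - 1"
    using q by (auto simp: prime_dvd_mult_iff)
  then show ?thesis
  proof cases
    case 1
    then have "flat_mod p q [:\<alpha>:]" by (simp add: flat_mod_def cyc_const)
    then have "flat_mod p q (h + [:\<alpha>:])" by (rule flat_mod_add[OF h])
    then have "flat_mod p q e" by (simp add: h_def)
    \<comment> \<open>\<open>e * f\<close> is \<open>f ^ M\<close>, which is \<open>f\<close> modulo
      \<open>q\<close>; hence a flat \<open>e\<close> makes \<open>f\<close> flat.\<close>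
    then have "flat_mod p q (e * f - (f ^ M - f))"
      by (intro flat_mod_diff[OF flat_mod_mult[OF p0] null_imp_flat_mod[OF fM]])
    moreover have "e * f - (f ^ M - f) = f" by (simp add: e_def N)
    ultimately show ?thesis by simp
  next
    case 2
    then have "flat_mod p q [:\<alpha> - 1:]" by (simp add: flat_mod_def cyc_const)
    then have "flat_mod p q (h + [:\<alpha> - 1:])" by (rule flat_mod_add[OF h])
    moreover have "h + [:\<alpha> - 1:] = e - 1" by (simp add: h_def one_pCons)
    \<comment> \<open>Now \<open>e - 1\<close> is flat, and \<open>g = e * g - (e - 1) * g\<close>,
      where \<open>e * g\<close> is a multiple of the null product \<open>f * g\<close>.\<close>
    ultimately have "flat_mod p q ((f * g) * f ^ N - (e - 1) * g)"
      using flat_mod_diff flat_mod_mult[OF p0] null_imp_flat_mod[OF fg] by metis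
    moreover have "(f * g) * f ^ N - (e - 1) * g = g" by (simp add: e_def N algebra_simps)
    ultimately show ?thesis by simp
  qed
qed

subsection \<open>Homomorphisms onto a group of prime order\<close>

text \<open>A surjective \<open>p\<close>-th power map on a finite set would be injective, but Sylow
  gives a subgroup of order \<open>p\<close>, all of whose elements have \<open>p\<close>-th power
  \<one>.\<close>

lemma (in comm_group) pow_image_proper:
  assumes fin: "finite (carrier G)" and p: "prime p" "p dvd Coset.order G"
  shows "(\<lambda>x. x [^] p) ` carrier G \<noteq> carrier G"
proof
  assume "(\<lambda>x. x [^] p) ` carrier G = carrier G"
  then have inj: "inj_on (\<lambda>x. x [^] p) (carrier G)"
    using fin by (simp add: eq_card_imp_inj_on)
  from p(2) obtain m where "Coset.order G = p ^ 1 * m" by auto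
  then obtain H where H: "subgroup H G" "card H = p"
    using sylow_thm[OF p(1) is_group _ fin] by (metis power_one_right)
  interpret H: subgroup H G by fact
  interpret HG: group "G\<lparr>carrier := H\<rparr>" by (rule H.subgroup_is_group) (rule is_group)
  have "H \<noteq> {\<one>}" using H(2) p(1) by auto
  then obtain x where x: "x \<in> H" "x \<noteq> \<one>" using H.one_closed by auto
  have "x [^]\<^bsub>G\<lparr>carrier := H\<rparr>\<^esub> Coset.order (G\<lparr>carrier := H\<rparr>) = \<one>"
    using HG.pow_order_eq_1[of x] x(1) by simp
  then have "x [^] p = \<one> [^] p"
    using H(2) by (simp add: Coset.order_def nat_pow_consistent[symmetric])
  then have "x = \<one>" by (rule inj_onD[OF inj]) (use x(1) in simp_all)
  then show False using x(2) by contradiction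
qed

text \<open>
  A maximal proper subgroup containing all \<open>p\<close>-th powers has index \<open>p\<close>; \<open>\<phi>\<close> is the projection
  to the quotient.
\<close>

lemma (in comm_group) ex_hom_mod_prime:
  assumes fin: "finite (carrier G)" and p: "prime p" "p dvd Coset.order G"
  obtains \<phi> :: "'a \<Rightarrow> nat" and t where
    "\<And>x y. x \<in> carrier G \<Longrightarrow> y \<in> carrier G \<Longrightarrow> [\<phi> (x \<otimes> y) = \<phi> x + \<phi> y] (mod p)"
    "t \<in> carrier G" "[\<phi> t = 1] (mod p)"
proof -
  let ?P = "(\<lambda>x. x [^] p) ` carrier G"
  let ?S = "{H. subgroup H G \<and> ?P \<subseteq> H \<and> H \<noteq> carrier G}"
  have P: "subgroup ?P G"
  proof (rule subgroupI)
    fix a assume "a \<in> ?P"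
    then obtain x where "x \<in> carrier G" "a = x [^] p" by auto
    then show "inv a \<in> ?P" by (auto intro!: image_eqI[of _ _ "inv x"] simp: nat_pow_inv)
  next
    fix a b assume "a \<in> ?P" "b \<in> ?P"
    then obtain x y where "x \<in> carrier G" "a = x [^] p" "y \<in> carrier G" "b = y [^] p" by auto
    then show "a \<otimes> b \<in> ?P" by (auto intro!: image_eqI[of _ _ "x \<otimes> y"] simp: nat_pow_distrib)
  qed auto
  have "finite ?S"
    by (rule finite_subset[of _ "Pow (carrier G)"]) (use fin in \<open>auto dest: subgroup.subset\<close>)
  moreover have "?P \<in> ?S" using P pow_image_proper[OF assms] by simp
  then have "?S \<noteq> {}" by (rule ex_in_conv[THEN iffD1, OF exI])
  ultimately have "\<exists>H\<in>?S. \<forall>K\<in>?S. H \<subseteq> K \<longrightarrow> H = K" by (rule finite_has_maximal)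
  then obtain H where H: "H \<in> ?S" and maximal: "\<forall>K\<in>?S. H \<subseteq> K \<longrightarrow> H = K"
    by (rule bexE)
  have PH: "?P \<subseteq> H" and HG: "H \<noteq> carrier G" using H by simp_all
  interpret H: subgroup H G using H by simp
  have "H \<subset> carrier G" using HG H.subset by (rule psubsetI[rotated])
  then obtain x where x: "x \<in> carrier G" "x \<notin> H" by (elim psubset_imp_ex_mem[elim_format]) auto
  \<comment> \<open>\<open>K\<close> is the subgroup generated by \<open>H\<close> and
    \<open>x\<close>; it exceeds \<open>H\<close>, so maximality forces it to be the whole
    group.\<close>
  define K where "K = {h \<otimes> x [^] i |h i. h \<in> H \<and> i \<in> (UNIV :: int set)}"
  have HK: "H \<subseteq> K"
  proof
    fix h assume "h \<in> H"
    then show "h \<in> K"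
      unfolding K_def using x by (intro CollectI exI[of _ h] exI[of _ 0]) auto
  qed
  have xK: "x \<in> K"
    unfolding K_def using x by (intro CollectI exI[of _ \<one>] exI[of _ 1]) (auto simp: int_pow_1)
  have K: "subgroup K G"
  proof (rule subgroupI)
    show "K \<subseteq> carrier G" using x H.subset by (auto simp: K_def)
    show "K \<noteq> {}" using xK by auto
  next
    fix a assume "a \<in> K"
    then obtain h i where "a = h \<otimes> x [^] (i::int)" "h \<in> H" by (auto simp: K_def)
    then show "inv a \<in> K"
      unfolding K_def using x
      by (intro CollectI exI[of _ "inv h"] exI[of _ "- i"]) (auto simp: inv_mult int_pow_neg)
  next
    fix a b assume "a \<in> K" "b \<in> K"
    then obtain h i k j where "a = h \<otimes> x [^] (i::int)" "h \<in> H" "b = k \<otimes> x [^] (j::int)" "k \<in> H"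
      by (auto simp: K_def)
    then show "a \<otimes> b \<in> K"
      unfolding K_def using x
      by (intro CollectI exI[of _ "h \<otimes> k"] exI[of _ "i + j"]) (auto simp: int_pow_mult m_ac)
  qed
  have KG: "K = carrier G"
  proof (rule ccontr)
    assume "K \<noteq> carrier G"
    then have "K \<in> ?S" using K order_trans[OF PH HK] by simp
    then have "H = K" using maximal HK by (metis (lifting))
    then show False using xK x by simp
  qed
  have xp: "x [^] int p \<in> H" using PH x by (auto simp: int_pow_int)
  \<comment> \<open>If \<open>p\<close> did not divide \<open>i\<close>, Bezout would express
    \<open>x\<close> through \<open>x [^] p\<close> and \<open>x [^] i\<close>, both in
    \<open>H\<close>.\<close>
  have xi: "int p dvd i" if i: "x [^] i \<in> H" for i :: int
  proof (rule ccontr)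
    assume "\<not> int p dvd i"
    then have "coprime (int p) i" using p(1) by (simp add: prime_imp_coprime)
    then obtain u w where uw: "u * int p + w * i = 1"
      using bezout_int[of "int p" i] by auto
    have "x = x [^] (int p * u + i * w)" using uw x by (simp add: mult.commute int_pow_1)
    also have "\<dots> = (x [^] int p) [^] u \<otimes> (x [^] i) [^] w"
      using x by (simp add: int_pow_mult int_pow_pow)
    also have "\<dots> \<in> H"
      using subgroup_int_pow_closed[OF H.subgroup_axioms] i xp by (intro H.m_closed)
    finally show False using x by simp
  qed
  \<comment> \<open>The exponent of \<open>x\<close> in a chosen decomposition of \<open>g\<close>;
    it is determined only modulo \<open>p\<close>, as \<open>uniq\<close> shows, and that suffices
    for a homomorphism.\<close>
  define \<iota> where "\<iota> g = (SOME i::int. \<exists>h\<in>H. g = h \<otimes> x [^] i)" for g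
  have \<iota>: "\<exists>h\<in>H. g = h \<otimes> x [^] \<iota> g" if "g \<in> carrier G" for g
  proof -
    from that have "g \<in> K" by (simp add: KG)
    then obtain h i where "h \<in> H" "g = h \<otimes> x [^] (i::int)" by (auto simp: K_def)
    then show ?thesis unfolding \<iota>_def by (intro someI_ex[of "\<lambda>i. \<exists>h\<in>H. g = h \<otimes> x [^] i"]) auto
  qed
  have uniq: "[\<iota> g = j] (mod int p)" if g: "g \<in> carrier G" "g = k \<otimes> x [^] j" "k \<in> H" for g k j
  proof -
    from \<iota>[OF g(1)] obtain h where h: "h \<in> H" "g = h \<otimes> x [^] \<iota> g" by blast
    have c: "h \<in> carrier G" "k \<in> carrier G" using h g by auto
    have "h \<otimes> x [^] (\<iota> g - j) = g \<otimes> inv (x [^] j)"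
      by (subst h(2)) (use x c in \<open>simp add: int_pow_diff m_assoc\<close>)
    also have "\<dots> = k" by (subst g(2)) (use x c in \<open>simp add: m_assoc\<close>)
    finally have "x [^] (\<iota> g - j) = inv h \<otimes> k"
      using x c by (metis int_pow_closed inv_solve_left)
    then have "x [^] (\<iota> g - j) \<in> H" using h g by simp
    then show ?thesis using xi by (simp add: cong_iff_dvd_diff)
  qed
  have p0: "0 < int p" using p(1) by (simp add: prime_gt_0_nat)
  show thesis
  proof (rule that[of "\<lambda>g. nat (\<iota> g mod int p)" x])
    fix y z assume yz: "y \<in> carrier G" "z \<in> carrier G"
    then obtain h k where hk: "h \<in> H" "y = h \<otimes> x [^] \<iota> y" "k \<in> H" "z = k \<otimes> x [^] \<iota> z"
      using \<iota> by metis
    have c: "h \<in> carrier G" "k \<in> carrier G" using hk by auto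
    have "y \<otimes> z = (h \<otimes> x [^] \<iota> y) \<otimes> (k \<otimes> x [^] \<iota> z)" using hk by simp
    also have "\<dots> = (h \<otimes> k) \<otimes> x [^] (\<iota> y + \<iota> z)" using x c by (simp add: int_pow_mult m_ac)
    finally have "[\<iota> (y \<otimes> z) = \<iota> y + \<iota> z] (mod int p)"
      by (rule uniq[OF m_closed[OF yz] _ H.m_closed[OF hk(1,3)]])
    then show "[nat (\<iota> (y \<otimes> z) mod int p) = nat (\<iota> y mod int p) + nat (\<iota> z mod int p)] (mod p)"
      using p0 by (simp add: cong_int_iff[symmetric] cong_def mod_simps)
  next
    have "[\<iota> x = 1] (mod int p)" using uniq[of x \<one> 1] x by (simp add: int_pow_1)
    then show "[nat (\<iota> x mod int p) = 1] (mod p)"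
      using p0 by (simp add: cong_int_iff[symmetric] cong_def mod_simps)
  qed (use x in simp)
qed

subsection \<open>Difference covers\<close>

text \<open>Negation modulo \<open>p\<close> is injective; zero sums express it without subtraction
  on naturals.\<close>

lemma cong_cancel_zero_sum_nat:
  fixes x y z w p :: nat
  assumes "[x + y = 0] (mod p)" "[z + w = 0] (mod p)"
  shows "[y = w] (mod p) \<longleftrightarrow> [x = z] (mod p)"
proof -
  have "[x + y = z + w] (mod p)" using assms by (metis cong_sym cong_trans)
  then show ?thesis
    by (metis cong_add cong_add_lcancel_nat cong_add_rcancel_nat cong_refl cong_sym cong_trans)
qed

text \<open>\<phi> represents a homomorphism onto the integers modulo \<open>p\<close>, with
  \<open>t\<close> witnessing surjectivity. Its values are naturals so that they can serve as
  exponents of monomials.\<close>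

locale mod_hom = comm_group +
  fixes p :: nat and \<phi> :: "'a \<Rightarrow> nat" and t :: 'a
  assumes fin: "finite (carrier G)" and p: "prime p"
    and \<phi>_mult: "x \<in> carrier G \<Longrightarrow> y \<in> carrier G \<Longrightarrow> [\<phi> (x \<otimes> y) = \<phi> x + \<phi> y] (mod p)"
    and t: "t \<in> carrier G" "[\<phi> t = 1] (mod p)"
begin

definition fibre :: "'a set \<Rightarrow> nat \<Rightarrow> 'a set" where
  "fibre A i = {x \<in> A. [\<phi> x = i] (mod p)}"

lemma \<phi>_one: "[\<phi> \<one> = 0] (mod p)"
proof -
  have "[\<phi> \<one> + \<phi> \<one> = \<phi> \<one> + 0] (mod p)"
    using \<phi>_mult[of \<one> \<one>] by (simp add: cong_sym)
  then show ?thesis by (simp only: cong_add_lcancel_nat)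
qed

lemma \<phi>_inv: "x \<in> carrier G \<Longrightarrow> [\<phi> x + \<phi> (inv x) = 0] (mod p)"
  using \<phi>_mult[of x "inv x"] \<phi>_one by (simp add: cong_def)

lemma \<phi>_pow: "[\<phi> (t [^] (i::nat)) = i] (mod p)"
proof (induction i)
  case (Suc i)
  have "[\<phi> (t [^] i \<otimes> t) = \<phi> (t [^] i) + \<phi> t] (mod p)" using t by (intro \<phi>_mult) auto
  also have "[\<phi> (t [^] i) + \<phi> t = i + 1] (mod p)" using Suc t(2) by (rule cong_add)
  finally show ?case by simp
qed (simp add: \<phi>_one)

text \<open>Translation by \<open>t [^] i\<close> carries the kernel to the fibre over
  \<open>i\<close>.\<close>

lemma card_fibre: "card (fibre (carrier G) i) = card (fibre (carrier G) 0)"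
proof -
  let ?s = "t [^] i"
  have s: "?s \<in> carrier G" using t by simp
  have "bij_betw (\<lambda>x. x \<otimes> ?s) (fibre (carrier G) 0) (fibre (carrier G) i)"
  proof (rule bij_betw_byWitness[where f' = "\<lambda>x. x \<otimes> inv ?s"])
    show "(\<lambda>x. x \<otimes> ?s) ` fibre (carrier G) 0 \<subseteq> fibre (carrier G) i"
    proof safe
      fix x assume x: "x \<in> fibre (carrier G) 0"
      then have "[\<phi> (x \<otimes> ?s) = \<phi> x + \<phi> ?s] (mod p)" by (intro \<phi>_mult) (auto simp: fibre_def s)
      also have "[\<phi> x + \<phi> ?s = 0 + i] (mod p)"
        using x \<phi>_pow by (intro cong_add) (auto simp: fibre_def)
      finally show "x \<otimes> ?s \<in> fibre (carrier G) i" using x s by (simp add: fibre_def)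
    qed
    show "(\<lambda>x. x \<otimes> inv ?s) ` fibre (carrier G) i \<subseteq> fibre (carrier G) 0"
    proof safe
      fix x assume x: "x \<in> fibre (carrier G) i"
      then have "[\<phi> (x \<otimes> inv ?s) = \<phi> x + \<phi> (inv ?s)] (mod p)"
        by (intro \<phi>_mult) (auto simp: fibre_def s)
      also have "[\<phi> x + \<phi> (inv ?s) = \<phi> ?s + \<phi> (inv ?s)] (mod p)"
        using x \<phi>_pow by (intro cong_add) (auto simp: fibre_def cong_def)
      also have "[\<phi> ?s + \<phi> (inv ?s) = 0] (mod p)" using s by (rule \<phi>_inv)
      finally show "x \<otimes> inv ?s \<in> fibre (carrier G) 0" using x s by (simp add: fibre_def)
    qed
  qed (use s in \<open>auto simp: fibre_def m_assoc\<close>)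
  then show ?thesis by (rule bij_betw_same_card[symmetric])
qed

lemma order_eq: "Coset.order G = p * card (fibre (carrier G) 0)"
proof -
  have "carrier G = (\<Union>i<p. fibre (carrier G) i)"
  proof safe
    fix x assume "x \<in> carrier G"
    then show "x \<in> (\<Union>i<p. fibre (carrier G) i)"
      using p by (auto simp: fibre_def prime_gt_0_nat cong_def intro!: bexI[of _ "\<phi> x mod p"])
  qed (simp add: fibre_def)
  also have "card \<dots> = (\<Sum>i<p. card (fibre (carrier G) i))"
    using fin by (intro card_UN_disjoint) (auto simp: fibre_def cong_def)
  also have "\<dots> = (\<Sum>i<p. card (fibre (carrier G) 0))"
    by (intro sum.cong refl card_fibre)
  finally show ?thesis by (simp add: Coset.order_def)
qed

end

text \<open>\<open>cnt\<close> is the group ring identity for one ordered pair of sets, read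
  coefficientwise. The value 0 at \<one> encodes that the sets are disjoint.\<close>

locale difference_cover = mod_hom +
  fixes A B :: "'a set" and l :: nat
  assumes A: "A \<subseteq> carrier G" and B: "B \<subseteq> carrier G"
    and cnt: "x \<in> carrier G \<Longrightarrow> card {(a, b). a \<in> A \<and> b \<in> B \<and> a \<otimes> inv b = x} = (if x = \<one> then 0 else l)"
begin

lemma finite_sides: "finite A" "finite B"
  using A B fin by (auto intro: finite_subset)

text \<open>Both sides count the pairs whose difference lies over \<open>i\<close>. The left side
  will reappear as a cyclic coefficient of a product of polynomials.\<close>

lemma sum_shifted_fibres:
  "(\<Sum>a\<in>A. \<Sum>b\<in>B. if [\<phi> a + \<phi> (inv b) = i] (mod p) then 1 else 0)
    = (\<Sum>x\<in>fibre (carrier G) i. if x = \<one> then 0 else l)"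
proof -
  have eq: "[\<phi> a + \<phi> (inv b) = i] (mod p) \<longleftrightarrow> a \<otimes> inv b \<in> fibre (carrier G) i"
    if "a \<in> A" "b \<in> B" for a b
  proof -
    have "a \<in> carrier G" "b \<in> carrier G" using that A B by auto
    then show ?thesis using \<phi>_mult[of a "inv b"] by (auto simp: fibre_def cong_def)
  qed
  have "(\<Sum>a\<in>A. \<Sum>b\<in>B. if [\<phi> a + \<phi> (inv b) = i] (mod p) then 1 else 0 :: nat)
      = (\<Sum>(a, b)\<in>A \<times> B. if a \<otimes> inv b \<in> fibre (carrier G) i then 1 else 0)"
    by (simp add: sum.cartesian_product[symmetric] eq cong: sum.cong)
  also have "\<dots> = card {(a, b). a \<in> A \<and> b \<in> B \<and> a \<otimes> inv b \<in> fibre (carrier G) i}"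
    using finite_sides
    by (subst card_eq_sum) (rule sum.mono_neutral_cong_right, auto split: if_splits)
  also have "{(a, b). a \<in> A \<and> b \<in> B \<and> a \<otimes> inv b \<in> fibre (carrier G) i}
      = (\<Union>x\<in>fibre (carrier G) i. {(a, b). a \<in> A \<and> b \<in> B \<and> a \<otimes> inv b = x})"
    by auto
  also have "card \<dots> = (\<Sum>x\<in>fibre (carrier G) i. card {(a, b). a \<in> A \<and> b \<in> B \<and> a \<otimes> inv b = x})"
  proof (rule card_UN_disjoint)
    show "finite (fibre (carrier G) i)" using fin by (simp add: fibre_def)
    show "\<forall>x\<in>fibre (carrier G) i. finite {(a, b). a \<in> A \<and> b \<in> B \<and> a \<otimes> inv b = x}"
      by (intro ballI finite_subset[OF _ finite_cartesian_product[OF finite_sides]]) auto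
  qed auto
  also have "\<dots> = (\<Sum>x\<in>fibre (carrier G) i. if x = \<one> then 0 else l)"
    by (rule sum.cong) (auto simp: fibre_def cnt)
  finally show ?thesis .
qed

text \<open>
  All fibres of \<open>A\<close> have at most \<open>order G / p \<le> q\<close> elements, so if their sizes agree modulo \<open>q\<close>, then
  either they agree, and differences are equidistributed over the fibres although \<open>\<one>\<close> is never a
  difference, or \<open>A\<close> is a union of cosets of the kernel of \<open>\<phi>\<close>, and a nontrivial kernel element
  \<open>a \<otimes> inv b\<close> forces \<open>b \<in> A \<inter> B\<close>.
\<close>

lemma fibre_cards_not_cong:
  assumes q: "1 < q" "Coset.order G \<le> p * q" and l: "0 < l"
    and flat: "\<And>i j. [card (fibre A i) = card (fibre A j)] (mod q)"
  shows False
proof (cases "\<forall>i. card (fibre A i) = card (fibre A 0)")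
  case True
  define n where "n = card (fibre (carrier G) 0)"
  have p1: "1 < p" using p by (rule prime_gt_1_nat)
  have one: "\<one> \<in> fibre (carrier G) 0" by (simp add: fibre_def \<phi>_one)
  \<comment> \<open>For fixed \<open>b\<close> the condition says that \<open>a\<close> lies over
    \<open>i + \<phi> b\<close>, and all fibres of \<open>A\<close> have the same size.\<close>
  have const: "(\<Sum>a\<in>A. \<Sum>b\<in>B. if [\<phi> a + \<phi> (inv b) = i] (mod p) then 1 else 0)
      = card B * card (fibre A 0)" for i
  proof -
    have "(\<Sum>a\<in>A. if [\<phi> a + \<phi> (inv b) = i] (mod p) then 1 else 0) = card (fibre A 0)"
      if b: "b \<in> B" for b
    proof -
      have "[\<phi> b + \<phi> (inv b) = 0] (mod p)" using b B by (intro \<phi>_inv) auto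
      then have "[i + (\<phi> b + \<phi> (inv b)) = i + 0] (mod p)" by (intro cong_add cong_refl)
      then have "[\<phi> a + \<phi> (inv b) = i] (mod p) \<longleftrightarrow> [\<phi> a + \<phi> (inv b) = (i + \<phi> b) + \<phi> (inv b)] (mod p)" for a
        by (simp add: cong_def add.assoc)
      then have "[\<phi> a + \<phi> (inv b) = i] (mod p) \<longleftrightarrow> [\<phi> a = i + \<phi> b] (mod p)" for a
        by (simp add: cong_add_rcancel_nat)
      then have "(\<Sum>a\<in>A. if [\<phi> a + \<phi> (inv b) = i] (mod p) then 1 else 0) = card (fibre A (i + \<phi> b))"
        using finite_sides by (simp add: sum.If_cases fibre_def Int_def)
      then show ?thesis using True by simp
    qed
    then show ?thesis by (subst sum.swap) simp
  qed
  \<comment> \<open>The fibre over 1 misses \<one> and yields \<open>n * l\<close>; the fibre over 0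
    contains it and yields \<open>(n - 1) * l\<close>. By \<open>const\<close> the two would be
    equal.\<close>
  have "(\<Sum>x\<in>fibre (carrier G) 1. if x = \<one> then 0 else l) = (\<Sum>x\<in>fibre (carrier G) 1. l)"
    using \<phi>_one p1 by (intro sum.cong) (auto simp: fibre_def cong_def)
  also have "\<dots> = n * l" by (simp only: n_def sum_constant card_fibre[of 1] of_nat_id)
  finally have 1: "card B * card (fibre A 0) = n * l"
    by (simp only: sum_shifted_fibres[of 1, symmetric] const)
  have finF: "finite (fibre (carrier G) 0)" using fin by (simp add: fibre_def)
  have "(\<Sum>x\<in>fibre (carrier G) 0. if x = \<one> then 0 else l) = (\<Sum>x\<in>fibre (carrier G) 0 - {\<one>}. l)"
    using one finF by (simp add: sum.remove[OF finF one])
  also have "\<dots> = (n - 1) * l" using one by (simp add: n_def)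
  finally have 2: "card B * card (fibre A 0) = (n - 1) * l"
    by (simp only: sum_shifted_fibres[of 0, symmetric] const)
  have "0 < n" using one finF by (auto simp: n_def card_gt_0_iff)
  with 1 2 l show False by (cases n) auto
next
  case False
  define n where "n = card (fibre (carrier G) 0)"
  have finF: "finite (fibre (carrier G) i)" for i using fin by (simp add: fibre_def)
  have sub: "fibre A i \<subseteq> fibre (carrier G) i" for i using A by (auto simp: fibre_def)
  have le: "card (fibre A i) \<le> n" for i
    using card_mono[OF finF sub, of i] by (simp add: n_def card_fibre[of i])
  have nq: "n \<le> q"
    using q(2) prime_gt_0_nat[OF p] by (simp add: order_eq n_def)
  obtain i where i: "card (fibre A i) \<noteq> card (fibre A 0)" using False by blast
  \<comment> \<open>Distinct congruent numbers between 0 and \<open>q\<close> can only be the two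
    endpoints.\<close>
  have small: "x = 0 \<and> y = q \<or> x = q \<and> y = 0" if "[x = y] (mod q)" "x \<noteq> y" "x \<le> q" "y \<le> q" for x y
    using that by (cases "x = q"; cases "y = q") (auto simp: cong_def)
  from i have "card (fibre A i) = 0 \<and> card (fibre A 0) = q \<or> card (fibre A i) = q \<and> card (fibre A 0) = 0"
    using small[OF flat] le nq by (meson le_trans)
  then have n: "n = q" and q0: "[card (fibre A 0) = 0] (mod q)"
    using le[of i] le[of 0] nq by (auto simp: cong_def)
  have full: "fibre A j = {} \<or> fibre A j = fibre (carrier G) j" for j
  proof -
    have "[card (fibre A j) = 0] (mod q)" using flat[of j 0] q0 by (rule cong_trans)
    then have "card (fibre A j) = 0 \<or> card (fibre A j) = q"
      using small[of "card (fibre A j)" 0] le[of j] nq by auto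
    then show ?thesis
    proof
      assume "card (fibre A j) = 0"
      then show ?thesis using finite_subset[OF sub finF] by simp
    next
      assume "card (fibre A j) = q"
      then show ?thesis
        using card_subset_eq[OF finF sub] n by (simp add: n_def card_fibre[of j])
    qed
  qed
  have "fibre (carrier G) 0 \<noteq> {\<one>}" using n q(1) by (auto simp: n_def)
  moreover have "\<one> \<in> fibre (carrier G) 0" by (simp add: fibre_def \<phi>_one)
  ultimately obtain u where u: "u \<in> fibre (carrier G) 0" "u \<noteq> \<one>" by auto
  then have "card {(a, b). a \<in> A \<and> b \<in> B \<and> a \<otimes> inv b = u} = l" by (simp add: cnt fibre_def)
  then have "{(a, b). a \<in> A \<and> b \<in> B \<and> a \<otimes> inv b = u} \<noteq> {}" using l by (metis card.empty less_irrefl)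
  then obtain a b where ab: "a \<in> A" "b \<in> B" "a \<otimes> inv b = u" by auto
  have c: "a \<in> carrier G" "b \<in> carrier G" using ab A B by auto
  then have "a = u \<otimes> b" using ab(3) by (auto simp: m_assoc)
  \<comment> \<open>As \<open>u\<close> lies over 0, \<open>a\<close> and \<open>b\<close> share a
    fibre; \<open>A\<close> meets it in \<open>a\<close> and therefore contains all of it.\<close>
  then have "[\<phi> a = \<phi> u + \<phi> b] (mod p)" using c u \<phi>_mult[of u b] by (simp add: fibre_def)
  also have "[\<phi> u + \<phi> b = 0 + \<phi> b] (mod p)" using u by (intro cong_add) (auto simp: fibre_def)
  finally have "b \<in> fibre (carrier G) (\<phi> a)" using c by (simp add: fibre_def cong_sym)
  moreover have "a \<in> fibre A (\<phi> a)" using ab by (simp add: fibre_def)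
  ultimately have "b \<in> A" using full[of "\<phi> a"] by (auto simp: fibre_def)
  then have "(b, b) \<in> {(a, b). a \<in> A \<and> b \<in> B \<and> a \<otimes> inv b = \<one>}" using ab c by simp
  moreover have "finite {(a, b). a \<in> A \<and> b \<in> B \<and> a \<otimes> inv b = \<one>}"
    by (intro finite_subset[OF _ finite_cartesian_product[OF finite_sides]]) auto
  ultimately show False using cnt[of \<one>] by auto
qed

end

text \<open>Either factor of the product may turn out flat, so the counts for both orders of the
  pair enter: flat \<open>f\<close> contradicts the cover by \<open>A\<close> and \<open>B\<close>,
  flat \<open>g\<close> the cover by \<open>B\<close> and \<open>A\<close>.\<close>

lemma (in comm_group) no_difference_covers:
  assumes fin: "finite (carrier G)" and p: "prime p" "p dvd Coset.order G"
    and q: "prime q" "coprime q p" "\<And>i. \<not> p dvd i \<Longrightarrow> \<exists>j. [q ^ j = i] (mod p)"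
    and bound: "Coset.order G \<le> p * q" and l: "q dvd l" "0 < l"
    and AB: "A \<subseteq> carrier G" "B \<subseteq> carrier G"
    and cntAB: "\<And>x. x \<in> carrier G \<Longrightarrow>
      card {(a, b). a \<in> A \<and> b \<in> B \<and> a \<otimes> inv b = x} = (if x = \<one> then 0 else l)"
    and cntBA: "\<And>x. x \<in> carrier G \<Longrightarrow>
      card {(a, b). a \<in> B \<and> b \<in> A \<and> a \<otimes> inv b = x} = (if x = \<one> then 0 else l)"
  shows False
proof -
  obtain \<phi> :: "'a \<Rightarrow> nat" and t where \<phi>:
    "\<And>x y. x \<in> carrier G \<Longrightarrow> y \<in> carrier G \<Longrightarrow> [\<phi> (x \<otimes> y) = \<phi> x + \<phi> y] (mod p)"
    "t \<in> carrier G" "[\<phi> t = 1] (mod p)"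
    using ex_hom_mod_prime[OF fin p] by blast
  interpret mod_hom G p \<phi> t by unfold_locales (use fin p \<phi> in auto)
  interpret AB: difference_cover G p \<phi> t A B l by unfold_locales (use AB cntAB in auto)
  interpret BA: difference_cover G p \<phi> t B A l by unfold_locales (use AB cntBA in auto)
  \<comment> \<open>\<open>f\<close> and \<open>g\<close> represent the images of \<open>A\<close>
    and of the inverted \<open>B\<close> in the group ring of the cyclic group of order
    \<open>p\<close>.\<close>
  define f :: "int poly" where "f = (\<Sum>a\<in>A. Polynomial.monom 1 (\<phi> a))"
  define g :: "int poly" where "g = (\<Sum>b\<in>B. Polynomial.monom 1 (\<phi> (inv b)))"
  have f: "cyc p f i = int (card (fibre A i))" for i
    using AB.finite_sides by (simp add: f_def cyc_sum cyc_monom sum.If_cases fibre_def Int_def)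
  have g: "cyc p g i = int (card {b \<in> B. [\<phi> (inv b) = i] (mod p)})" for i
    using AB.finite_sides by (simp add: g_def cyc_sum cyc_monom sum.If_cases Int_def)
  have "null_mod p q (f * g)"
    unfolding null_mod_def
  proof
    fix i
    have "cyc p (f * g) i
        = int (\<Sum>a\<in>A. \<Sum>b\<in>B. if [\<phi> a + \<phi> (inv b) = i] (mod p) then 1 else 0)"
      unfolding f_def g_def sum_product cyc_sum mult_monom cyc_monom of_nat_sum
      by (intro sum.cong refl) simp
    moreover have "q dvd (\<Sum>x\<in>fibre (carrier G) i. if x = \<one> then 0 else l)"
      using l by (intro dvd_sum) auto
    ultimately show "int q dvd cyc p (f * g) i"
      using AB.sum_shifted_fibres[of i] by (metis of_nat_dvd_iff)
  qed
  from flat_mod_or_flat_mod[OF p(1) q(1,2,3) this] show False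
  proof
    assume "flat_mod p q f"
    then have "[card (fibre A i) = card (fibre A j)] (mod q)" for i j
      by (simp add: flat_mod_def f cong_int_iff[symmetric] cong_iff_dvd_diff)
    then show False using AB.fibre_cards_not_cong[of q] bound l prime_gt_1_nat[OF q(1)] by blast
  next
    assume flat: "flat_mod p q g"
    \<comment> \<open>\<open>i * (p - 1)\<close> is \<open>-i\<close> modulo \<open>p\<close>, so
      the fibre sizes of \<open>B\<close> are the coefficients of \<open>g\<close> at negated
      indices.\<close>
    have "fibre B i = {b \<in> B. [\<phi> (inv b) = i * (p - 1)] (mod p)}" for i
    proof -
      have "i + i * (p - 1) = i * p" using prime_gt_0_nat[OF p(1)] by (cases p) auto
      then have "[i + i * (p - 1) = 0] (mod p)" by (simp add: cong_def)
      then have "[\<phi> (inv b) = i * (p - 1)] (mod p) \<longleftrightarrow> [\<phi> b = i] (mod p)" if "b \<in> B" for b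
        using cong_cancel_zero_sum_nat[OF \<phi>_inv] that AB(2) by blast
      then show ?thesis by (auto simp: fibre_def)
    qed
    then have "int (card (fibre B i)) = cyc p g (i * (p - 1))" for i
      by (simp only: g)
    then have "int q dvd int (card (fibre B i)) - int (card (fibre B j))" for i j
      using flat by (simp only: flat_mod_def)
    then have "[card (fibre B i) = card (fibre B j)] (mod q)" for i j
      by (simp only: cong_int_iff[symmetric] cong_iff_dvd_diff)
    then show False using BA.fibre_cards_not_cong[of q] bound l prime_gt_1_nat[OF q(1)] by blast
  qed
qed

subsection \<open>Strong external difference families with two sets\<close>

lemma gr_set_inv_eq:
  assumes "comm_group G" "finite (carrier G)" "A \<subseteq> carrier G"
  shows "gr_set_inv G A = (\<lambda>x. \<Sum>a\<in>A. of_bool (x = inv\<^bsub>G\<^esub> a))"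
proof -
  interpret comm_group G by fact
  have "gr_set_inv G A = (\<lambda>x. \<Sum>a\<in>A. gr_elem (inv\<^bsub>G\<^esub> a) x)"
    unfolding gr_set_inv_def using assms finite_subset[OF assms(3,2)]
    by (intro finsum_int_group_ring)
      (auto simp: int_group_ring_simps gr_elem_def intro: inv_closed[OF subsetD[OF assms(3)]])
  then show ?thesis by (simp add: gr_elem_def)
qed

lemma gr_set_inv_closed:
  assumes "comm_group G" "finite (carrier G)" "A \<subseteq> carrier G"
  shows "gr_set_inv G A \<in> carrier (int_group_ring G)"
proof -
  interpret comm_group G by fact
  show ?thesis
    by (auto simp: gr_set_inv_eq[OF assms] int_group_ring_simps intro!: sum.neutral
        inv_closed[OF subsetD[OF assms(3)]])
qed

lemma add_pow_int_group_ring: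
  fixes l :: nat
  assumes "comm_group G" "finite (carrier G)"
  shows "[l] \<cdot>\<^bsub>int_group_ring G\<^esub> f = (\<lambda>x. int l * f x)"
proof -
  interpret cring "int_group_ring G" using assms by (rule cring_int_group_ring)
  show ?thesis
  proof (induction l)
    case 0
    then show ?case by (simp add: add_pow_def int_group_ring_simps nat_pow_def)
  next
    case (Suc l)
    then show ?case
      by (simp add: add_pow_def int_group_ring_simps nat_pow_def fun_eq_iff algebra_simps)
  qed
qed

lemma minus_int_group_ring:
  assumes "comm_group G" "finite (carrier G)"
    and "f \<in> carrier (int_group_ring G)" "g \<in> carrier (int_group_ring G)"
  shows "f \<ominus>\<^bsub>int_group_ring G\<^esub> g = (\<lambda>x. f x - g x)"
proof -
  interpret cring "int_group_ring G" using assms(1,2) by (rule cring_int_group_ring)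
  have "\<ominus>\<^bsub>int_group_ring G\<^esub> g = (\<lambda>x. - g x)"
    using assms(4) by (intro minus_equality) (auto simp: int_group_ring_simps)
  then show ?thesis by (simp add: a_minus_def int_group_ring_simps)
qed

text \<open>The coefficient of \<open>x\<close> in the convolution counts pairs with
  \<open>inv a \<otimes> x = inv b\<close>, that is, \<open>a \<otimes> inv b = x\<close>.\<close>

lemma card_differences:
  assumes G: "comm_group G" "finite (carrier G)" and AB: "A \<subseteq> carrier G" "B \<subseteq> carrier G"
    and eq: "gr_set G A \<otimes>\<^bsub>int_group_ring G\<^esub> gr_set_inv G B
        = [l] \<cdot>\<^bsub>int_group_ring G\<^esub>
            (gr_set G (carrier G) \<ominus>\<^bsub>int_group_ring G\<^esub> \<one>\<^bsub>int_group_ring G\<^esub>)"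
    and x: "x \<in> carrier G"
  shows "card {(a, b). a \<in> A \<and> b \<in> B \<and> a \<otimes>\<^bsub>G\<^esub> inv\<^bsub>G\<^esub> b = x}
    = (if x = \<one>\<^bsub>G\<^esub> then 0 else l)"
proof -
  interpret comm_group G by fact
  have fin: "finite A" "finite B" using AB G by (auto intro: finite_subset)
  have sol: "inv\<^bsub>G\<^esub> a \<otimes>\<^bsub>G\<^esub> x = inv\<^bsub>G\<^esub> b \<longleftrightarrow> a \<otimes>\<^bsub>G\<^esub> inv\<^bsub>G\<^esub> b = x"
    if "a \<in> A" "b \<in> B" for a b
  proof -
    have "a \<in> carrier G" "b \<in> carrier G" using that AB by auto
    then show ?thesis using x by (metis inv_closed inv_solve_left' m_closed inv_solve_left)
  qed
  have minus: "gr_set G (carrier G) \<ominus>\<^bsub>int_group_ring G\<^esub> \<one>\<^bsub>int_group_ring G\<^esub>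
      = (\<lambda>x. of_bool (x \<in> carrier G) - of_bool (x = \<one>\<^bsub>G\<^esub>))"
    by (subst minus_int_group_ring[OF G]) (auto simp: gr_set_eq[OF G] int_group_ring_simps)
  have "int (card {(a, b). a \<in> A \<and> b \<in> B \<and> a \<otimes>\<^bsub>G\<^esub> inv\<^bsub>G\<^esub> b = x})
      = (\<Sum>(a, b)\<in>A \<times> B. of_bool (a \<otimes>\<^bsub>G\<^esub> inv\<^bsub>G\<^esub> b = x))"
    using fin by (simp add: case_prod_unfold of_bool_def sum.If_cases)
      (rule arg_cong[of _ _ card], auto)
  also have "\<dots> = (\<Sum>a\<in>A. \<Sum>b\<in>B. of_bool (inv\<^bsub>G\<^esub> a \<otimes>\<^bsub>G\<^esub> x = inv\<^bsub>G\<^esub> b))"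
    by (simp add: sum.cartesian_product[symmetric] sol cong: sum.cong)
  also have "\<dots> = (\<Sum>y\<in>carrier G. of_bool (y \<in> A) *
      (\<Sum>b\<in>B. of_bool (inv\<^bsub>G\<^esub> y \<otimes>\<^bsub>G\<^esub> x = inv\<^bsub>G\<^esub> b)))"
    using AB G by (intro sum.mono_neutral_cong_left) auto
  also have "\<dots> = (gr_set G A \<otimes>\<^bsub>int_group_ring G\<^esub> gr_set_inv G B) x"
    using x AB by (simp add: int_group_ring_simps gr_set_eq[OF G] gr_set_inv_eq[OF G])
  also have "\<dots> = int l * (1 - of_bool (x = \<one>\<^bsub>G\<^esub>))"
    unfolding eq minus using x by (simp add: add_pow_int_group_ring[OF G])
  finally show ?thesis by (auto split: if_splits)
qed

text \<open>A number prime to \<open>p\<close> is a unit modulo \<open>p ^ d\<close>, hence a power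
  of \<open>q\<close> there; the congruence then descends to \<open>p\<close>.\<close>

lemma residue_primroot_powers:
  assumes "prime p" "0 < d" "residue_primroot (p ^ d) q" "\<not> p dvd i"
  shows "\<exists>j. [q ^ j = i] (mod p)"
proof -
  have p1: "1 < p ^ d" using prime_gt_1_nat[OF assms(1)] assms(2) by (rule one_less_power)
  have "coprime i (p ^ d)"
    using prime_imp_coprime[OF assms(1,4)] by (simp add: coprime_commute)
  then have c: "coprime (i mod p ^ d) (p ^ d)"
    using p1 by (simp only: coprime_mod_left_iff)
  \<comment> \<open>\<open>totatives\<close> contains only positive numbers, so the residue 0 has to
    be excluded.\<close>
  moreover have "i mod p ^ d \<noteq> 0"
  proof
    assume "i mod p ^ d = 0"
    then show False using c p1 by (auto simp: coprime_0_left_iff)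
  qed
  moreover have "i mod p ^ d \<le> p ^ d" using p1 by (intro less_imp_le mod_less_divisor) linarith
  ultimately have "i mod p ^ d \<in> totatives (p ^ d)" by (simp only: totatives_def) simp
  then obtain j where "q ^ j mod p ^ d = i mod p ^ d"
    using bij_betw_imp_surj_on[OF residue_primroot_is_generator[OF p1 assms(3)]]
    by (metis (no_types, lifting) imageE)
  then have "[q ^ j = i] (mod p ^ d)" by (simp add: cong_def)
  then show ?thesis using assms(2) by (meson cong_dvd_modulus_nat dvd_power)
qed

text \<open>Common core of the three cases. With two sets, each sum over the other indices has a
  single term, which gives the counts for both orders.\<close>

lemma no_two_set_sedf:
  fixes G :: "('a, 'b) monoid_scheme"
  assumes p: "prime p" "0 < d" "p dvd v" and q: "prime q" "residue_primroot (p ^ d) q"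
    and bound: "v \<le> p * q" and l: "q dvd l"
  shows "\<not> is_sedf G v 2 k l D"
proof
  assume sedf: "is_sedf G v 2 k l D"
  then interpret comm_group G by (simp add: is_sedf_def)
  have G: "comm_group G" "finite (carrier G)" using sedf by (simp_all add: is_sedf_def)
  interpret R: cring "int_group_ring G" using G by (rule cring_int_group_ring)
  have set: "{1..2::nat} = {1, 2}" by auto
  have sub: "D 1 \<subseteq> carrier G" "D 2 \<subseteq> carrier G"
    using sedf by (simp_all add: is_sedf_def set)
  have inv: "gr_set_inv G (D i) \<in> carrier (int_group_ring G)" if "i \<in> {1, 2}" for i
    using that gr_set_inv_closed[OF G sub(1)] gr_set_inv_closed[OF G sub(2)] by auto
  have sum: "(\<Oplus>\<^bsub>int_group_ring G\<^esub>i\<in>{j}. gr_set_inv G (D i)) = gr_set_inv G (D j)"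
    if "j \<in> {1, 2}" for j
    using inv[OF that] by simp
  have diff: "{1, 2} - {1} = {2::nat}" "{1, 2} - {2} = {1::nat}" by auto
  have fam: "gr_set G (D j) \<otimes>\<^bsub>int_group_ring G\<^esub>
        (\<Oplus>\<^bsub>int_group_ring G\<^esub>i\<in>{1, 2} - {j}. gr_set_inv G (D i)) = [l] \<cdot>\<^bsub>int_group_ring G\<^esub>
        (gr_set G (carrier G) \<ominus>\<^bsub>int_group_ring G\<^esub> \<one>\<^bsub>int_group_ring G\<^esub>)"
    if "j \<in> {1, 2}" for j
    using sedf that unfolding is_sedf_def set by blast
  have eq:
    "gr_set G (D 1) \<otimes>\<^bsub>int_group_ring G\<^esub> gr_set_inv G (D 2) = [l] \<cdot>\<^bsub>int_group_ring G\<^esub>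
        (gr_set G (carrier G) \<ominus>\<^bsub>int_group_ring G\<^esub> \<one>\<^bsub>int_group_ring G\<^esub>)"
    "gr_set G (D 2) \<otimes>\<^bsub>int_group_ring G\<^esub> gr_set_inv G (D 1) = [l] \<cdot>\<^bsub>int_group_ring G\<^esub>
        (gr_set G (carrier G) \<ominus>\<^bsub>int_group_ring G\<^esub> \<one>\<^bsub>int_group_ring G\<^esub>)"
    using fam[of 1] fam[of 2] by (simp_all only: diff sum insert_iff simp_thms)
  have "coprime q p"
    using q(2) p(2) by (simp add: residue_primroot_def coprime_commute)
  moreover have "Coset.order G = v" "0 < l" using sedf by (simp_all add: is_sedf_def)
  ultimately show False
    using no_difference_covers[OF G(2) p(1) _ q(1) _ residue_primroot_powers[OF p(1,2) q(2)]
        _ l _ sub card_differences[OF G sub eq(1)] card_differences[OF G sub(2,1) eq(2)]]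
      p(3) bound by blast
qed

theorem theorem4p3:
  fixes p1 p2 :: nat
  assumes "prime p1" and "prime p2" and "p1 < p2"
  shows
    "(\<forall>p d :: nat.
        prime p \<and> 0 < d \<and> exactly_divides p d (p1 * p2^2 + 1) \<and>
        residue_primroot (p ^ d) p1 \<and> p2^2 + 1 \<le> p \<longrightarrow>
        \<not> (\<exists>(G :: ('a, 'b) monoid_scheme) D.
              is_sedf G (p1 * p2^2 + 1) 2 (p1 * p2) p1 D)) \<and>
     (\<forall>p d :: nat.
        prime p \<and> 0 < d \<and> exactly_divides p d (p1^2 * p2 + 1) \<and>
        residue_primroot (p ^ d) p2 \<and> p1^2 + 1 \<le> p \<longrightarrow>
        \<not> (\<exists>(G :: ('a, 'b) monoid_scheme) D.
              is_sedf G (p1^2 * p2 + 1) 2 (p1 * p2) p2 D)) \<and>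
     (\<forall>p d :: nat.
        prime p \<and> 0 < d \<and> exactly_divides p d (p2^2 + 1) \<and>
        (residue_primroot (p ^ d) p1 \<and> p2^2 + 1 < p1 * p \<or>
         residue_primroot p p1 \<and> p2^2 + 1 = p1 * p) \<longrightarrow>
        \<not> (\<exists>(G :: ('a, 'b) monoid_scheme) D.
              is_sedf G (p2^2 + 1) 2 (p1 * p2) (p1^2) D))"
proof -
  have dvd: "p dvd v" if "0 < d" "exactly_divides p d v" for p d v :: nat
    using that by (meson dvd_power dvd_trans exactly_divides_def)
  have bound: "q * s + 1 \<le> p * q" if "prime q" "s + 1 \<le> p" for p q s :: nat
  proof -
    have "q * s + 1 \<le> q * (s + 1)" using prime_gt_0_nat[OF that(1)] by simp
    also have "\<dots> \<le> q * p" using that(2) by (rule mult_le_mono2)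
    finally show ?thesis by (simp add: mult.commute)
  qed
  have 1: "\<not> is_sedf G (p1 * p2^2 + 1) 2 (p1 * p2) p1 D"
    if "prime p" "0 < d" "exactly_divides p d (p1 * p2^2 + 1)"
      "residue_primroot (p ^ d) p1" "p2^2 + 1 \<le> p"
    for p d D and G :: "('a, 'b) monoid_scheme"
    by (rule no_two_set_sedf[OF that(1,2) dvd[OF that(2,3)] assms(1) that(4)
          bound[OF assms(1) that(5)] dvd_refl])
  have 2: "\<not> is_sedf G (p1^2 * p2 + 1) 2 (p1 * p2) p2 D"
    if "prime p" "0 < d" "exactly_divides p d (p1^2 * p2 + 1)"
      "residue_primroot (p ^ d) p2" "p1^2 + 1 \<le> p"
    for p d D and G :: "('a, 'b) monoid_scheme"
  proof -
    have "p1^2 * p2 + 1 \<le> p * p2" using bound[OF assms(2) that(5)] by (simp add: mult.commute)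
    then show ?thesis
      by (rule no_two_set_sedf[OF that(1,2) dvd[OF that(2,3)] assms(2) that(4) _ dvd_refl])
  qed
  \<comment> \<open>A separate exponent \<open>e\<close> for the primitive root covers both
    alternatives, with \<open>e = d\<close> for the strict bound and \<open>e = 1\<close> for
    equality.\<close>
  have 3: "\<not> is_sedf G (p2^2 + 1) 2 (p1 * p2) (p1^2) D"
    if "prime p" "0 < d" "exactly_divides p d (p2^2 + 1)"
      "residue_primroot (p ^ e) p1" "0 < e" "p2^2 + 1 \<le> p1 * p"
    for p d e D and G :: "('a, 'b) monoid_scheme"
  proof -
    have "p2^2 + 1 \<le> p * p1" using that(6) by (simp add: mult.commute)
    then show ?thesis
      by (rule no_two_set_sedf[OF that(1,5) dvd[OF that(2,3)] assms(1) that(4)]) simp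
  qed
  show ?thesis
  proof (intro conjI allI impI notI; elim conjE exE disjE)
  qed (use 1 2 3 3[where e = 1] in \<open>auto simp del: One_nat_def\<close>)
qed

end
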